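(* Let $M\in\mathbb{R}^{d\times d}$, $A=A_M=\begin{pmatrix}I&M+\frac12I \\ I&M-\frac12I\end{pmatrix}$, and $\varphi_\lambda(t)=e^{-\pi t^2/\lambda}$ for $t\in\mathbb{R}^d$, $\lambda>0$. Then, for all $x,\omega\in\mathbb{R}^d$, $$\mathcal{B}_A\varphi_\lambda(x,\omega)=(2\lambda)^{d/2}\det(S)^{-1/2}\,e^{-2\pi x^2/\lambda}\,e^{8\pi(M^\top x\cdot S^{-1}M^\top x)/\lambda}\,e^{8\pi i\,S^{-1}\omega\cdot M^\top x}\,e^{-2\pi\lambda\,\omega\cdot S^{-1}\omega},$$ where $S=I+4M^\top M\in\mathbb{R}^{d\times d}$.
   Context: For $t\in\mathbb{R}^d$, $t^2=t\cdot t$. For $A\in\mathrm{GL}(2d,\mathbb{R})$ with $d\times d$ blocks $A_{ij}$, $\mathcal{B}_Af(x,\omega)=\int_{\mathbb{R}^d}e^{-2\pi i\omega\cdot y}f(A_{11}x+A_{12}y)\overline{f(A_{21}x+A_{22}y)}\,dy$. *)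

theory Defs
  imports "HOL-Analysis.Analysis"
begin

text \<open>
  A real \<open>2d \<times> 2d\<close> matrix is indexed by \<open>'n + 'n\<close> with \<open>d = CARD('n)\<close>; \<open>Inl\<close> and \<open>Inr\<close>
  are the first and the last \<open>d\<close> indices.
\<close>

definition block_matrix ::
  "real^'n^'n \<Rightarrow> real^'n^'n \<Rightarrow> real^'n^'n \<Rightarrow> real^'n^'n \<Rightarrow> real^('n::finite + 'n)^('n + 'n)" where
  "block_matrix P Q R T = (\<chi> i j.
     case i of
       Inl k \<Rightarrow> (case j of Inl l \<Rightarrow> P $ k $ l | Inr l \<Rightarrow> Q $ k $ l)
     | Inr k \<Rightarrow> (case j of Inl l \<Rightarrow> R $ k $ l | Inr l \<Rightarrow> T $ k $ l))"

definition block11 :: "real^('n::finite + 'n)^('n + 'n) \<Rightarrow> real^'n^'n" where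
  "block11 A = (\<chi> k l. A $ Inl k $ Inl l)"

definition block12 :: "real^('n::finite + 'n)^('n + 'n) \<Rightarrow> real^'n^'n" where
  "block12 A = (\<chi> k l. A $ Inl k $ Inr l)"

definition block21 :: "real^('n::finite + 'n)^('n + 'n) \<Rightarrow> real^'n^'n" where
  "block21 A = (\<chi> k l. A $ Inr k $ Inl l)"

definition block22 :: "real^('n::finite + 'n)^('n + 'n) \<Rightarrow> real^'n^'n" where
  "block22 A = (\<chi> k l. A $ Inr k $ Inr l)"

lemma blocks_block_matrix [simp]:
  "block11 (block_matrix P Q R T) = P" "block12 (block_matrix P Q R T) = Q"
  "block21 (block_matrix P Q R T) = R" "block22 (block_matrix P Q R T) = T"
  by (simp_all add: block_matrix_def block11_def block12_def block21_def block22_def vec_eq_iff)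

text \<open>
  The distribution is meant for invertible \<open>A\<close>, but the formula is stated for all \<open>A\<close>.
  The Bochner integral is \<open>0\<close> when the integrand is not integrable.
\<close>

definition bilinear_dist ::
  "real^('n::finite + 'n)^('n + 'n) \<Rightarrow> (real^'n \<Rightarrow> complex) \<Rightarrow> real^'n \<Rightarrow> real^'n \<Rightarrow> complex" where
  "bilinear_dist A f x \<omega> =
     (LINT y|lebesgue. exp (- 2 * of_real pi * \<i> * of_real (\<omega> \<bullet> y))
        * f (block11 A *v x + block12 A *v y) * cnj (f (block21 A *v x + block22 A *v y)))"

definition mat_AM :: "real^'n^'n \<Rightarrow> real^('n::finite + 'n)^('n + 'n)" where
  "mat_AM M = block_matrix (mat 1) (M + (1/2) *\<^sub>R mat 1) (mat 1) (M - (1/2) *\<^sub>R mat 1)"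

lemma block_matrix_mult:
  "block_matrix P Q R T ** block_matrix P' Q' R' T' =
   block_matrix (P ** P' + Q ** R') (P ** Q' + Q ** T') (R ** P' + T ** R') (R ** Q' + T ** T')"
proof -
  have *: "(\<Sum>k\<in>UNIV. g k) = (\<Sum>k\<in>UNIV. g (Inl k)) + (\<Sum>k\<in>UNIV. g (Inr k))"
    for g :: "'n::finite + 'n \<Rightarrow> real"
    by (subst UNIV_Plus_UNIV [symmetric], subst sum.Plus) simp_all
  show ?thesis
    by (auto simp: vec_eq_iff block_matrix_def matrix_matrix_mult_def * split: sum.split)
qed

lemma block_matrix_id: "block_matrix (mat 1) 0 0 (mat 1) = mat 1"
  by (auto simp: vec_eq_iff block_matrix_def mat_def split: sum.split)

lemma invertible_mat_AM: "invertible (mat_AM M)"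
  for M :: "real^'n^'n"
proof -
  let ?P = "M + (1/2) *\<^sub>R mat 1" and ?Q = "M - (1/2) *\<^sub>R mat 1"
  have PQ: "?P - ?Q = mat 1"
    by (simp add: scaleR_left_distrib [symmetric])
  have neg: "B ** (- C) = - (B ** C)" for B C :: "real^'n^'n"
    by (simp add: vec_eq_iff matrix_matrix_mult_def sum_negf)
  have "mat_AM M ** block_matrix (- ?Q) ?P (mat 1) (- mat 1) = mat 1"
    unfolding mat_AM_def block_matrix_mult block_matrix_id [symmetric]
    using PQ by (simp add: neg)
  then show ?thesis
    using invertible_right_inverse by blast
qed

definition gauss :: "real \<Rightarrow> real^'n::finite \<Rightarrow> complex" where
  "gauss lam t = of_real (exp (- pi * (t \<bullet> t) / lam))"

end

theory Submission
  imports Defs "HOL-Probability.Characteristic_Functions"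
begin

text \<open>
  Write \<open>u = M\<^sup>T x\<close>.  The two arguments of the Gaussian are \<open>x + M y \<plusminus> y/2\<close>, so by the
  parallelogram law their squared lengths add up to
  \<open>2 x\<cdot>x + 4 u\<cdot>y + (1/2) y\<cdot>S y\<close>.  The value of the distribution is therefore
  \<open>exp (-2\<pi> x\<cdot>x/\<lambda>)\<close> times an integral
  \<open>\<integral> exp (-\<pi> y\<cdot>B y - 2\<pi> p\<cdot>y - 2\<pi>i \<omega>\<cdot>y) dy\<close> with \<open>B = S/(2\<lambda>)\<close> positive definite
  and \<open>p = 2u/\<lambda>\<close>.

  Such an integral equals
  \<open>exp (\<pi> (p + i\<omega>)\<cdot>B\<^sup>-\<^sup>1(p + i\<omega>)) / sqrt (det B)\<close>, where the dot is extended bilinearly: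
  this is \<open>lborel_integral_gaussian_positive_definite\<close>.  Inserting \<open>B\<close> and \<open>p\<close> and
  separating real and imaginary part of the exponent gives the theorem.

  To evaluate it, choose \<open>T\<close> with \<open>T\<^sup>T B T = I\<close>; its columns are an orthonormal basis for the
  form \<open>v\<cdot>B w\<close> (\<open>positive_definite_congruent_identity\<close>).  Then \<open>B\<^sup>-\<^sup>1 = T T\<^sup>T\<close> and
  \<open>\<bar>det T\<bar> = 1 / sqrt (det B)\<close>, and the substitution \<open>y = T w\<close> (\<open>lborel_integral_linear\<close>) leaves an
  integral with quadratic part \<open>w\<cdot>w\<close>, which is a product of integrals over the real line.
  Each of those is a shifted and scaled characteristic function of the standard normal
  distribution (\<open>has_bochner_integral_gaussian_real\<close>).
\<close>

section \<open>Linear changes of variables for the Lebesgue measure\<close>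

text \<open>
  Because \<open>v\<close> has no \<open>b\<close>-component, \<open>v \<bullet> x\<close> does not depend on the coordinate of \<open>x\<close> along \<open>b\<close>.
  Integrating over that coordinate first, the shear is a translation of the real line.
\<close>

lemma nn_integral_lborel_shear:
  fixes f :: "'a::euclidean_space \<Rightarrow> ennreal"
  assumes f [measurable]: "f \<in> borel_measurable borel"
    and b: "b \<in> Basis" and v: "v \<bullet> b = 0"
  shows "(\<integral>\<^sup>+x. f (x + (v \<bullet> x) *\<^sub>R b) \<partial>lborel) = (\<integral>\<^sup>+x. f x \<partial>lborel)"
proof -
  interpret product_sigma_finite "\<lambda>_::'a. lborel :: real measure"
    by standard
  define I where "I = (Basis - {b} :: 'a set)"
  have Basis_eq: "Basis = insert b I" and I: "finite I" "b \<notin> I"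
    using b by (auto simp: I_def)
  (* Fubini: the coordinate along b is split off as the inner variable y. *)
  have coords: "(\<integral>\<^sup>+x. g x \<partial>lborel) =
      (\<integral>\<^sup>+z. (\<integral>\<^sup>+y. g ((\<Sum>i\<in>I. z i *\<^sub>R i) + y *\<^sub>R b) \<partial>lborel) \<partial>Pi\<^sub>M I (\<lambda>_. lborel))"
    if [measurable]: "g \<in> borel_measurable borel" for g :: "'a \<Rightarrow> ennreal"
  proof -
    have "(\<integral>\<^sup>+x. g x \<partial>lborel) =
        (\<integral>\<^sup>+z. g (\<Sum>i\<in>insert b I. z i *\<^sub>R i) \<partial>Pi\<^sub>M (insert b I) (\<lambda>_. lborel))"
      by (subst lborel_eq, subst nn_integral_distr) (simp_all add: Basis_eq [symmetric])
    also have "\<dots> = (\<integral>\<^sup>+z. (\<integral>\<^sup>+y. g (\<Sum>i\<in>insert b I. (z(b := y)) i *\<^sub>R i) \<partial>lborel) \<partial>Pi\<^sub>M I (\<lambda>_. lborel))"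
      using I by (subst product_nn_integral_insert) simp_all
    also have "\<dots> = (\<integral>\<^sup>+z. (\<integral>\<^sup>+y. g ((\<Sum>i\<in>I. z i *\<^sub>R i) + y *\<^sub>R b) \<partial>lborel) \<partial>Pi\<^sub>M I (\<lambda>_. lborel))"
    proof -
      have "(\<Sum>i\<in>insert b I. (z(b := y)) i *\<^sub>R i) = (\<Sum>i\<in>I. z i *\<^sub>R i) + y *\<^sub>R b" for z y
      proof -
        have "(\<Sum>i\<in>I. (z(b := y)) i *\<^sub>R i) = (\<Sum>i\<in>I. z i *\<^sub>R i)"
          using I by (intro sum.cong) auto
        then show ?thesis
          using I by (simp add: add.commute del: fun_upd_apply) simp
      qed
      then show ?thesis
        by (simp only:)
    qed
    finally show ?thesis .
  qed
  have "(\<integral>\<^sup>+y. f (w + y *\<^sub>R b + (v \<bullet> (w + y *\<^sub>R b)) *\<^sub>R b) \<partial>lborel) = (\<integral>\<^sup>+y. f (w + y *\<^sub>R b) \<partial>lborel)" for w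
  proof -
    have *: "w + y *\<^sub>R b + (v \<bullet> (w + y *\<^sub>R b)) *\<^sub>R b = w + (v \<bullet> w + 1 * y) *\<^sub>R b" for y
      using v by (simp add: inner_add_right algebra_simps)
    then show ?thesis
      using nn_integral_real_affine [of "\<lambda>y. f (w + y *\<^sub>R b)" 1 "v \<bullet> w"] by (simp only: *) simp
  qed
  then show ?thesis
    by (simp add: coords)
qed

lemma borel_measurable_matrix_vector_mult [measurable]:
  "(*v) A \<in> borel_measurable borel" for A :: "real^'n^'m"
  by (intro borel_measurable_continuous_onI linear_continuous_on linear_conv_bounded_linear[THEN iffD1]) simp

lemma Basis_eq_range_axis: "(Basis :: (real^'n) set) = range (\<lambda>i. axis i 1)"
  by (auto simp: Basis_vec_def)

lemma inj_axis: "inj (\<lambda>i. axis i 1 :: real^'n)"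
  by (auto simp: inj_def axis_eq_axis)

text \<open>
  Every matrix is a product of diagonal matrices, transpositions, elementary shears and matrices
  with a zero row, and the formula is multiplicative in \<open>A\<close>.  A diagonal matrix rescales
  the coordinates, a transposition maps boxes to boxes of the same volume, and a shear was
  treated above; a zero row contradicts invertibility.  The index type carries no order, so
  the determinant of a shear is read off from a row operation on the identity instead of from
  triangularity.
\<close>

lemma nn_integral_lborel_linear:
  fixes A :: "real^'n^'n" and f :: "real^'n \<Rightarrow> ennreal"
  assumes "det A \<noteq> 0" and "f \<in> borel_measurable borel"
  shows "(\<integral>\<^sup>+x. f x \<partial>lborel) = ennreal \<bar>det A\<bar> * (\<integral>\<^sup>+x. f (A *v x) \<partial>lborel)"
proof -
  have "det A \<noteq> 0 \<longrightarrow> (\<forall>f\<in>borel_measurable borel. (\<integral>\<^sup>+x. f x \<partial>lborel) = ennreal \<bar>det A\<bar> * (\<integral>\<^sup>+x. f (A *v x) \<partial>lborel))"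
    (is "?P A")
  proof (rule induct_matrix_elementary [where P = ?P]; intro impI ballI)
    fix A B :: "real^'n^'n" and f :: "real^'n \<Rightarrow> ennreal"
    assume A: "?P A" and B: "?P B" and ne: "det (A ** B) \<noteq> 0"
      and f [measurable]: "f \<in> borel_measurable borel"
    have "(\<integral>\<^sup>+x. f x \<partial>lborel) = ennreal \<bar>det A\<bar> * (\<integral>\<^sup>+x. f (A *v x) \<partial>lborel)"
      by (rule A[rule_format]) (use ne in \<open>auto simp: det_mul\<close>)
    also have "(\<integral>\<^sup>+x. f (A *v x) \<partial>lborel) = ennreal \<bar>det B\<bar> * (\<integral>\<^sup>+x. f (A *v (B *v x)) \<partial>lborel)"
      by (rule B[rule_format, of "\<lambda>x. f (A *v x)"]) (use ne in \<open>auto simp: det_mul\<close>)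
    finally show "(\<integral>\<^sup>+x. f x \<partial>lborel) = ennreal \<bar>det (A ** B)\<bar> * (\<integral>\<^sup>+x. f ((A ** B) *v x) \<partial>lborel)"
      by (simp add: det_mul abs_mult ennreal_mult' matrix_vector_mul_assoc mult.assoc)
  next
    fix A :: "real^'n^'n" and i f
    assume "row i A = 0" "det A \<noteq> 0"
    then show "(\<integral>\<^sup>+x. f x \<partial>lborel) = ennreal \<bar>det A\<bar> * (\<integral>\<^sup>+x. f (A *v x) \<partial>lborel)"
      by (simp add: det_zero_row)
  next
    fix A :: "real^'n^'n" and f :: "real^'n \<Rightarrow> ennreal"
    assume diag: "\<And>i j. i \<noteq> j \<Longrightarrow> A $ i $ j = 0" and ne: "det A \<noteq> 0"
      and f [measurable]: "f \<in> borel_measurable borel"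
    have det: "det A = (\<Prod>i\<in>UNIV. A $ i $ i)"
      by (rule det_diagonal) (rule diag)
    (* The diagonal entries as a function of the basis vectors, the format of lborel_affine_euclidean. *)
    define c where "c b = (\<Sum>i\<in>UNIV. A $ i $ i * b $ i)" for b :: "real^'n"
    have c_axis [simp]: "c (axis i 1) = A $ i $ i" for i
      by (simp add: c_def axis_def if_distrib cong: if_cong)
    have Ax: "0 + (\<Sum>j\<in>Basis. (c j * (x \<bullet> j)) *\<^sub>R j) = A *v x" for x
    proof -
      have "A $ k $ k * x $ k = (\<Sum>j\<in>UNIV. A $ k $ j * x $ j)" for k
        using diag by (subst sum.remove[of _ k]) auto
      moreover have "(\<Sum>j\<in>Basis. (c j * (x \<bullet> j)) *\<^sub>R j) = (\<Sum>i\<in>UNIV. (A $ i $ i * x $ i) *\<^sub>R axis i 1)"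
        by (simp add: Basis_eq_range_axis sum.reindex[OF inj_axis] inner_axis)
      ultimately show ?thesis
        by (simp add: vec_eq_iff matrix_vector_mult_def axis_def if_distrib cong: if_cong)
    qed
    have prod: "(\<Prod>j\<in>Basis. \<bar>c j\<bar>) = \<bar>det A\<bar>"
      by (simp add: det Basis_eq_range_axis prod.reindex[OF inj_axis] abs_prod)
    have "c j \<noteq> 0" if "j \<in> Basis" for j
      using that ne by (auto simp: Basis_eq_range_axis det)
    from lborel_affine_euclidean[of c 0, OF this]
    have "lborel = density (distr lborel borel ((*v) A)) (\<lambda>_. ennreal \<bar>det A\<bar>)"
      by (simp only: Ax prod)
    then have "(\<integral>\<^sup>+x. f x \<partial>lborel) = (\<integral>\<^sup>+x. f x \<partial>density (distr lborel borel ((*v) A)) (\<lambda>_. ennreal \<bar>det A\<bar>))"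
      by (rule arg_cong)
    then show "(\<integral>\<^sup>+x. f x \<partial>lborel) = ennreal \<bar>det A\<bar> * (\<integral>\<^sup>+x. f (A *v x) \<partial>lborel)"
      by (simp add: nn_integral_density nn_integral_distr nn_integral_cmult)
  next
    fix m n :: 'n and f :: "real^'n \<Rightarrow> ennreal"
    let ?A = "(\<chi> i j. mat 1 $ i $ Transposition.transpose m n j) :: real^'n^'n"
    let ?t = "Transposition.transpose m n"
    assume "m \<noteq> n" and f [measurable]: "f \<in> borel_measurable borel"
    have det: "\<bar>det ?A\<bar> = 1"
      by (simp add: det_permute_columns permutes_swap_id sign_swap_id abs_mult)
    have Av: "?A *v x = (\<chi> i. x $ ?t i)" for x
    proof -
      have "mat 1 $ i $ ?t j * x $ j = (if j = ?t i then x $ j else 0)" for i j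
        by (auto simp: mat_def)
      then show ?thesis
        by (simp add: vec_eq_iff matrix_vector_mult_def)
    qed
    have "lborel = distr lborel borel ((*v) ?A)"
    proof (rule lborel_eqI)
      fix l u :: "real^'n" assume le: "\<And>b. b \<in> Basis \<Longrightarrow> l \<bullet> b \<le> u \<bullet> b"
      have vimage: "(*v) ?A -` box l u = box (?A *v l) (?A *v u)"
        unfolding Av by (auto simp: mem_box_cart) (metis transpose_involutory)+
      have prod: "(\<Prod>b\<in>Basis. (?A *v u - ?A *v l) \<bullet> b) = (\<Prod>b\<in>Basis. (u - l) \<bullet> b)"
      proof -
        have "(\<Prod>b\<in>Basis. w \<bullet> b) = (\<Prod>i\<in>UNIV. w $ i)" for w :: "real^'n"
          by (simp add: Basis_eq_range_axis prod.reindex[OF inj_axis] inner_axis)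
        moreover have "(\<Prod>i\<in>UNIV. u $ ?t i - l $ ?t i) = (\<Prod>i\<in>UNIV. u $ i - l $ i)"
          using prod.permute[OF permutes_swap_id, where S = UNIV and g = "\<lambda>i. u $ i - l $ i", of m n]
          by (simp add: o_def)
        ultimately show ?thesis
          by (simp add: Av)
      qed
      have "(?A *v l) \<bullet> b \<le> (?A *v u) \<bullet> b" if "b \<in> Basis" for b
      proof -
        have "l $ i \<le> u $ i" for i
          using le[of "axis i 1"] by (simp add: inner_axis)
        then show ?thesis
          using that by (auto simp: Basis_eq_range_axis Av inner_axis)
      qed
      then have "emeasure lborel (box (?A *v l) (?A *v u)) = (\<Prod>b\<in>Basis. (?A *v u - ?A *v l) \<bullet> b)"
        by (rule emeasure_lborel_box)
      then show "emeasure (distr lborel borel ((*v) ?A)) (box l u) = ennreal (\<Prod>b\<in>Basis. (u - l) \<bullet> b)"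
        by (simp add: emeasure_distr vimage prod)
    qed simp
    then have "(\<integral>\<^sup>+x. f x \<partial>lborel) = (\<integral>\<^sup>+x. f x \<partial>distr lborel borel ((*v) ?A))"
      by (rule arg_cong)
    then show "(\<integral>\<^sup>+x. f x \<partial>lborel) = ennreal \<bar>det ?A\<bar> * (\<integral>\<^sup>+x. f (?A *v x) \<partial>lborel)"
      by (simp only: det) (simp add: nn_integral_distr)
  next
    fix m n :: 'n and c :: real and f :: "real^'n \<Rightarrow> ennreal"
    let ?A = "(\<chi> i j. if i = m \<and> j = n then c else of_bool (i = j)) :: real^'n^'n"
    assume mn: "m \<noteq> n" and f [measurable]: "f \<in> borel_measurable borel"
    have "?A = (\<chi> k. if k = m then row m (mat 1) + c *s row n (mat 1) else row k (mat 1))"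
      using mn by (auto simp: vec_eq_iff row_def mat_def)
    then have det: "det ?A = 1"
      using det_row_operation[OF mn, of "mat 1 :: real^'n^'n" c] by simp
    have "?A *v x = x + ((c *\<^sub>R axis n 1) \<bullet> x) *\<^sub>R axis m 1" for x
    proof -
      have "(\<Sum>j\<in>UNIV. (if i = m \<and> j = n then c else of_bool (i = j)) * x $ j) = x $ i + (if i = m then c * x $ n else 0)" for i
      proof -
        have "(\<Sum>j\<in>UNIV. (if i = m \<and> j = n then c else of_bool (i = j)) * x $ j) =
          (\<Sum>j\<in>UNIV. (if j = i then x $ j else 0) + (if j = n then if i = m then c * x $ j else 0 else 0))"
          using mn by (intro sum.cong) auto
        then show ?thesis
          by (simp add: sum.distrib)
      qed
      moreover have "(c *\<^sub>R axis n 1) \<bullet> x = c * x $ n"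
        by (simp add: inner_axis')
      ultimately show ?thesis
        by (auto simp: vec_eq_iff matrix_vector_mult_def axis_def)
    qed
    moreover have "(c *\<^sub>R axis n 1) \<bullet> (axis m 1 :: real^'n) = 0"
      using mn by (simp add: inner_axis_axis)
    ultimately show "(\<integral>\<^sup>+x. f x \<partial>lborel) = ennreal \<bar>det ?A\<bar> * (\<integral>\<^sup>+x. f (?A *v x) \<partial>lborel)"
      using nn_integral_lborel_shear[OF f, of "axis m 1" "c *\<^sub>R axis n 1"]
      by (simp add: det)
  qed
  then show ?thesis
    using assms by blast
qed

text \<open>
  As an equation between measures, the formula also applies to integrals of functions with
  values in a Banach space.
\<close>

lemma lborel_eq_density_linear:
  fixes A :: "real^'n^'n"
  assumes "det A \<noteq> 0"
  shows "lborel = density (distr lborel borel ((*v) A)) (\<lambda>_. ennreal \<bar>det A\<bar>)"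
proof (rule measure_eqI)
  fix X :: "(real^'n) set" assume "X \<in> sets lborel"
  then have [measurable]: "X \<in> sets borel" by simp
  have "emeasure lborel X = (\<integral>\<^sup>+x. indicator X x \<partial>lborel)"
    by simp
  also have "\<dots> = ennreal \<bar>det A\<bar> * (\<integral>\<^sup>+x. indicator X (A *v x) \<partial>lborel)"
    by (rule nn_integral_lborel_linear[OF assms]) simp
  also have "\<dots> = emeasure (density (distr lborel borel ((*v) A)) (\<lambda>_. ennreal \<bar>det A\<bar>)) X"
    by (simp add: emeasure_density nn_integral_distr nn_integral_cmult del: nn_integral_indicator)
  finally show "emeasure lborel X = emeasure (density (distr lborel borel ((*v) A)) (\<lambda>_. ennreal \<bar>det A\<bar>)) X" .
qed simp

lemma lborel_integral_linear:
  fixes A :: "real^'n^'n" and f :: "real^'n \<Rightarrow> 'b::{banach, second_countable_topology}"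
  assumes "det A \<noteq> 0" and f [measurable]: "f \<in> borel_measurable borel"
  shows "(\<integral>x. f x \<partial>lborel) = \<bar>det A\<bar> *\<^sub>R (\<integral>x. f (A *v x) \<partial>lborel)"
  by (subst lborel_eq_density_linear[OF assms(1)]) (simp add: integral_density integral_distr)

section \<open>Matrix algebra and positive definite forms\<close>

lemma matrix_inv_eqI:
  fixes A B :: "'a::field^'n^'n"
  assumes "A ** B = mat 1"
  shows "matrix_inv A = B"
proof -
  have "B ** A = mat 1"
    using assms by (simp add: matrix_left_right_inverse)
  then have "matrix_inv A ** A = mat 1"
    unfolding matrix_inv_def using assms by (rule_tac someI2[where a = B]) auto
  then show ?thesis
    using assms by (metis matrix_mul_assoc matrix_mul_lid matrix_mul_rid)
qed

lemma inner_matrix_vector_mult: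
  "x \<bullet> (A *v y) = (transpose A *v x) \<bullet> y" for A :: "real^'n^'m"
  by (simp add: dot_lmul_matrix flip: vector_transpose_matrix)

lemma det_scaleR: "det (c *\<^sub>R A) = c ^ CARD('n) * det A" for A :: "real^'n^'n"
  using det_rows_mul[of "\<lambda>_. c" "\<lambda>i. A $ i"]
  by (simp add: scaleR_vec_def vector_scalar_mult_def)

text \<open>
  Orthonormality refers to the inner product \<open>u \<bullet> (S *v v)\<close>.  As long as there are fewer than
  \<open>CARD('n)\<close> vectors \<open>v\<close>, their images \<open>S *v v\<close> do not span the space, so some nonzero
  vector is orthogonal to all these images; normalised, it extends the set.
\<close>

lemma orthonormal_set_for_form:
  fixes S :: "real^'n^'n"
  assumes sym: "transpose S = S" and pos: "\<And>v. v \<noteq> 0 \<Longrightarrow> v \<bullet> (S *v v) > 0"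
    and "k \<le> CARD('n)"
  shows "\<exists>B. finite B \<and> card B = k \<and> (\<forall>u\<in>B. \<forall>v\<in>B. u \<bullet> (S *v v) = of_bool (u = v))"
  using \<open>k \<le> CARD('n)\<close>
proof (induction k)
  case 0
  then show ?case
    by (intro exI[of _ "{}"]) simp
next
  case (Suc k)
  then obtain B where B: "finite B" "card B = k" "\<forall>u\<in>B. \<forall>v\<in>B. u \<bullet> (S *v v) = of_bool (u = v)"
    by auto
  have "dim ((*v) S ` B) < DIM(real^'n)"
    using dim_le_card'[of "(*v) S ` B"] card_image_le[of B "(*v) S"] B Suc.prems by simp
  then obtain x where x: "x \<noteq> 0" "\<And>y. y \<in> span ((*v) S ` B) \<Longrightarrow> orthogonal x y"
    by (rule orthogonal_to_subspace_exists) blast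
  define u where "u = (1 / sqrt (x \<bullet> (S *v x))) *\<^sub>R x"
  have uu: "u \<bullet> (S *v u) = 1"
    using pos[OF x(1)] by (simp add: u_def matrix_vector_mult_scaleR)
  have uv: "u \<bullet> (S *v v) = 0" if "v \<in> B" for v
    using x(2)[of "S *v v"] that by (simp add: u_def orthogonal_def span_base)
  have vu: "v \<bullet> (S *v u) = 0" if "v \<in> B" for v
    using uv[OF that] by (metis sym dot_lmul_matrix inner_commute vector_transpose_matrix)
  have "u \<notin> B"
    using uu uv by force
  then show ?case
    using B uu uv vu by (intro exI[of _ "insert u B"]) auto
qed

text \<open>
  The entries of \<open>transpose T ** S ** T\<close> are the values of the form \<open>S\<close> on pairs of columns of
  \<open>T\<close>, so the columns are taken to be an orthonormal basis for that form.
\<close>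

lemma positive_definite_congruent_identity:
  fixes S :: "real^'n^'n"
  assumes "transpose S = S" and "\<And>v. v \<noteq> 0 \<Longrightarrow> v \<bullet> (S *v v) > 0"
  obtains T :: "real^'n^'n" where "transpose T ** S ** T = mat 1"
proof -
  obtain B :: "(real^'n) set" where B: "finite B" "card B = CARD('n)" "\<forall>u\<in>B. \<forall>v\<in>B. u \<bullet> (S *v v) = of_bool (u = v)"
    using orthonormal_set_for_form[OF assms order_refl] by auto
  then obtain h where h: "bij_betw h (UNIV :: 'n set) B"
    using finite_same_card_bij[of "UNIV :: 'n set" B] by auto
  define T :: "real^'n^'n" where "T = (\<chi> i j. h j $ i)"
  have "(transpose T ** (S ** T)) $ i $ j = h i \<bullet> (S *v h j)" for i j
    by (simp add: matrix_matrix_mult_def transpose_def T_def inner_vec_def matrix_vector_mult_def)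
  also have "\<dots> i j = of_bool (i = j)" for i j
    using B(3) h by (auto simp: bij_betw_def inj_def)
  finally have "transpose T ** S ** T = mat 1"
    by (simp add: vec_eq_iff mat_def matrix_mul_assoc)
  then show ?thesis ..
qed

lemma positive_definite_det_pos:
  fixes S :: "real^'n^'n"
  assumes "transpose S = S" and "\<And>v. v \<noteq> 0 \<Longrightarrow> v \<bullet> (S *v v) > 0"
  shows "det S > 0"
proof -
  obtain T :: "real^'n^'n" where "transpose T ** S ** T = mat 1"
    by (rule positive_definite_congruent_identity[OF assms])
  then have "det (transpose T ** S ** T) = 1"
    by simp
  then have "(det T)\<^sup>2 * det S = 1"
    by (simp add: det_mul det_transpose power2_eq_square mult.commute mult.left_commute)
  then show ?thesis
    by (metis zero_less_mult_pos zero_less_one zero_less_power2 mult_zero_left power_zero_numeral zero_neq_one)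
qed

section \<open>Gaussian integrals\<close>

text \<open>
  The exponent is \<open>-\<pi> (y + p)\<^sup>2 - 2\<pi>iq (y + p)\<close> plus the constant \<open>\<pi>p\<^sup>2 + 2\<pi>ipq\<close>.  The real shift
  \<open>y + p\<close> is an ordinary substitution, and the imaginary linear term is handled by the
  characteristic function of the normal distribution, so no contour has to be moved.
\<close>

lemma has_bochner_integral_gaussian_real:
  fixes p q :: real
  shows "has_bochner_integral lborel
    (\<lambda>y. exp (of_real (- pi * y\<^sup>2 - 2 * pi * p * y) - 2 * of_real pi * \<i> * of_real (q * y)))
    (exp (of_real (pi * (p\<^sup>2 - q\<^sup>2)) + 2 * of_real pi * \<i> * of_real (p * q)) :: complex)"
proof -
  (* The substitution C * (p + y) turns the weight exp (-x^2 / 2) into exp (-pi * (p + y)^2). *)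
  define C where "C = sqrt (2 * pi)"
  have C: "C > 0" "C\<^sup>2 = 2 * pi"
    by (simp_all add: C_def)
  (* The constant left over from completing the square, times the normalisation of the density. *)
  define K where "K = exp (of_real (pi * p\<^sup>2) + 2 * of_real pi * \<i> * of_real (p * q)) * complex_of_real C"
  define t where "t = - q * C"
  interpret real_distribution std_normal_distribution
    by (rule real_dist_normal_dist)
  have "integrable std_normal_distribution (\<lambda>x. iexp (t * x))"
    by (rule integrable_iexp) auto
  moreover have "(LINT x|std_normal_distribution. iexp (t * x)) = complex_of_real (exp (- (t\<^sup>2) / 2))"
    using char_std_normal_distribution by (simp add: char_def fun_eq_iff)
  ultimately have "has_bochner_integral lborel
      (\<lambda>x. std_normal_density x *\<^sub>R iexp (t * x)) (complex_of_real (exp (- (t\<^sup>2) / 2)))"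
    by (simp add: has_bochner_integral_iff integrable_density integral_density)
  then have "has_bochner_integral lborel
      (\<lambda>y. std_normal_density (C * p + C * y) *\<^sub>R iexp (t * (C * p + C * y)))
      (complex_of_real (exp (- (t\<^sup>2) / 2)) /\<^sub>R \<bar>C\<bar>)"
    using C by (subst (asm) lborel_has_bochner_integral_real_affine_iff[of C _ _ "C * p"]) auto
  then have "has_bochner_integral lborel
      (\<lambda>y. K * (std_normal_density (C * p + C * y) *\<^sub>R iexp (t * (C * p + C * y))))
      (K * (complex_of_real (exp (- (t\<^sup>2) / 2)) /\<^sub>R \<bar>C\<bar>))"
    by (rule has_bochner_integral_mult_right)
  moreover have "K * (complex_of_real (exp (- (t\<^sup>2) / 2)) /\<^sub>R \<bar>C\<bar>) =
      exp (of_real (pi * (p\<^sup>2 - q\<^sup>2)) + 2 * of_real pi * \<i> * of_real (p * q))"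
  proof -
    have "- (t\<^sup>2) / 2 = - pi * q\<^sup>2"
      using C by (simp add: t_def power_mult_distrib)
    then show ?thesis
      using C by (simp add: K_def scaleR_conv_of_real field_simps exp_of_real[symmetric] flip: exp_add)
  qed
  moreover have "K * (std_normal_density (C * p + C * y) *\<^sub>R iexp (t * (C * p + C * y))) =
      exp (of_real (- pi * y\<^sup>2 - 2 * pi * p * y) - 2 * of_real pi * \<i> * of_real (q * y))" for y
  proof -
    have sq: "- (C * p + C * y)\<^sup>2 / 2 = - pi * (p + y)\<^sup>2"
      using C by (simp add: distrib_left[symmetric] power_mult_distrib)
    have dens: "std_normal_density (C * p + C * y) = exp (- pi * (p + y)\<^sup>2) / C"
      unfolding std_normal_density_def sq by (simp add: C_def)
    have lin: "t * (C * p + C * y) = - 2 * pi * q * (p + y)"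
    proof -
      have "t * (C * p + C * y) = - C\<^sup>2 * q * (p + y)"
        by (simp add: t_def power2_eq_square algebra_simps)
      then show ?thesis using C by simp
    qed
    have "K * (std_normal_density (C * p + C * y) *\<^sub>R iexp (t * (C * p + C * y))) =
      exp (of_real (pi * p\<^sup>2) + 2 * of_real pi * \<i> * of_real (p * q)) *
      exp (of_real (- pi * (p + y)\<^sup>2)) * exp (\<i> * of_real (- 2 * pi * q * (p + y)))"
      unfolding dens lin K_def using C by (simp add: scaleR_conv_of_real flip: exp_of_real)
    also have "\<dots> = exp (of_real (- pi * y\<^sup>2 - 2 * pi * p * y) - 2 * of_real pi * \<i> * of_real (q * y))"
      unfolding exp_add[symmetric]
      by (rule arg_cong[where f = exp]) (simp add: power2_eq_square algebra_simps)
    finally show ?thesis .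
  qed
  ultimately show ?thesis
    by simp
qed

lemma lborel_integral_prod:
  fixes f :: "'a::euclidean_space \<Rightarrow> real \<Rightarrow> 'b::{real_normed_field, banach, second_countable_topology}"
  assumes "\<And>b. b \<in> Basis \<Longrightarrow> integrable lborel (f b)"
  shows "(\<integral>x. (\<Prod>b\<in>Basis. f b (x \<bullet> b)) \<partial>lborel) = (\<Prod>b\<in>Basis. \<integral>t. f b t \<partial>lborel)"
proof -
  interpret product_sigma_finite "\<lambda>_::'a. lborel :: real measure"
    by standard
  have [measurable]: "f b \<in> borel_measurable borel" if "b \<in> Basis" for b
    using assms[OF that] by simp
  have "(\<integral>x. (\<Prod>b\<in>Basis. f b (x \<bullet> b)) \<partial>lborel) =
      (\<integral>z. (\<Prod>b\<in>Basis. f b ((\<Sum>i\<in>Basis. z i *\<^sub>R i) \<bullet> b)) \<partial>Pi\<^sub>M Basis (\<lambda>_. lborel))"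
    by (subst lborel_eq, subst integral_distr) simp_all
  also have "\<dots> = (\<integral>z. (\<Prod>b\<in>Basis. f b (z b)) \<partial>Pi\<^sub>M Basis (\<lambda>_. lborel))"
    by (intro Bochner_Integration.integral_cong refl prod.cong) simp
  also have "\<dots> = (\<Prod>b\<in>Basis. \<integral>t. f b t \<partial>lborel)"
    by (rule product_integral_prod) (use assms in auto)
  finally show ?thesis .
qed

lemma lborel_integral_gaussian:
  fixes p q :: "'a::euclidean_space"
  shows "(\<integral>y. exp (of_real (- pi * (y \<bullet> y) - 2 * pi * (p \<bullet> y)) - 2 * of_real pi * \<i> * of_real (q \<bullet> y)) \<partial>lborel) =
    (exp (of_real (pi * (p \<bullet> p - q \<bullet> q)) + 2 * of_real pi * \<i> * of_real (p \<bullet> q)) :: complex)"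
proof -
  let ?f = "\<lambda>b y. exp (of_real (- pi * y\<^sup>2 - 2 * pi * (p \<bullet> b) * y) - 2 * of_real pi * \<i> * of_real ((q \<bullet> b) * y)) :: complex"
  have "exp (of_real (- pi * (y \<bullet> y) - 2 * pi * (p \<bullet> y)) - 2 * of_real pi * \<i> * of_real (q \<bullet> y)) =
      (\<Prod>b\<in>Basis. ?f b (y \<bullet> b))" for y :: 'a
    unfolding exp_sum[OF finite_Basis, symmetric]
    by (simp add: euclidean_inner[of _ y] power2_eq_square sum_subtractf sum_distrib_left sum_negf mult.assoc)
  moreover have "exp (of_real (pi * (p \<bullet> p - q \<bullet> q)) + 2 * of_real pi * \<i> * of_real (p \<bullet> q)) =
      (\<Prod>b\<in>Basis. exp (of_real (pi * ((p \<bullet> b)\<^sup>2 - (q \<bullet> b)\<^sup>2)) + 2 * of_real pi * \<i> * of_real ((p \<bullet> b) * (q \<bullet> b))) :: complex)"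
  proof -
    have "p \<bullet> p - q \<bullet> q = (\<Sum>b\<in>Basis. (p \<bullet> b)\<^sup>2 - (q \<bullet> b)\<^sup>2)"
      by (simp add: power2_eq_square sum_subtractf flip: euclidean_inner)
    moreover have "p \<bullet> q = (\<Sum>b\<in>Basis. (p \<bullet> b) * (q \<bullet> b))"
      by (rule euclidean_inner)
    ultimately show ?thesis
      unfolding exp_sum[OF finite_Basis, symmetric] sum.distrib of_real_sum[symmetric] sum_distrib_left[symmetric]
      by (simp only:)
  qed
  moreover have "(\<integral>y. (\<Prod>b\<in>Basis. ?f b (y \<bullet> b)) \<partial>lborel) = (\<Prod>b\<in>Basis. \<integral>t. ?f b t \<partial>lborel)"
    by (rule lborel_integral_prod) (use has_bochner_integral_gaussian_real in \<open>auto simp: has_bochner_integral_iff\<close>)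
  ultimately show ?thesis
    using has_bochner_integral_gaussian_real by (simp only: has_bochner_integral_iff)
qed

text \<open>
  Substituting \<open>y = T w\<close> with \<open>T\<^sup>T B T = I\<close> replaces \<open>B\<close> by the identity, \<open>p\<close> by \<open>T\<^sup>T p\<close>
  and \<open>q\<close> by \<open>T\<^sup>T q\<close>.  Since \<open>B\<^sup>-\<^sup>1 = T T\<^sup>T\<close>, inner products of the new vectors are values of the
  form \<open>B\<^sup>-\<^sup>1\<close> on the old ones.
\<close>

lemma lborel_integral_gaussian_positive_definite:
  fixes B :: "real^'n^'n" and p q :: "real^'n"
  assumes "transpose B = B" and "\<And>v. v \<noteq> 0 \<Longrightarrow> v \<bullet> (B *v v) > 0"
  shows "(\<integral>y. exp (of_real (- pi * (y \<bullet> (B *v y)) - 2 * pi * (p \<bullet> y)) - 2 * of_real pi * \<i> * of_real (q \<bullet> y)) \<partial>lborel) =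
    of_real (det B powr (- 1 / 2)) *
    (exp (of_real (pi * (p \<bullet> (matrix_inv B *v p) - q \<bullet> (matrix_inv B *v q)))
      + 2 * of_real pi * \<i> * of_real (p \<bullet> (matrix_inv B *v q))) :: complex)"
proof -
  let ?g = "\<lambda>y. exp (of_real (- pi * (y \<bullet> (B *v y)) - 2 * pi * (p \<bullet> y)) - 2 * of_real pi * \<i> * of_real (q \<bullet> y)) :: complex"
  obtain T :: "real^'n^'n" where T: "transpose T ** B ** T = mat 1"
    by (rule positive_definite_congruent_identity[OF assms])
  have detT: "(det T)\<^sup>2 * det B = 1"
    using arg_cong[OF T, of det] by (simp add: det_mul det_transpose power2_eq_square mult.commute mult.left_commute)
  then have "det T \<noteq> 0"
    by auto
  have abs_det: "\<bar>det T\<bar> = det B powr (- 1 / 2)"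
  proof -
    have "det B = \<bar>det T\<bar> powr (- 2)"
      using detT \<open>det T \<noteq> 0\<close> by (simp add: powr_minus field_simps)
    then show ?thesis
      using \<open>det T \<noteq> 0\<close> by (simp add: powr_powr)
  qed
  (* For square matrices a left inverse is a right inverse; this is used twice to reorder the factors. *)
  have "T ** (transpose T ** B) = mat 1"
    using T matrix_left_right_inverse by blast
  then have "B ** (T ** transpose T) = mat 1"
    using matrix_left_right_inverse by (metis matrix_mul_assoc)
  then have inv: "matrix_inv B = T ** transpose T"
    by (rule matrix_inv_eqI)
  have inner_inv: "v \<bullet> (matrix_inv B *v w) = (transpose T *v v) \<bullet> (transpose T *v w)" for v w
    unfolding inv by (simp add: inner_matrix_vector_mult flip: matrix_vector_mul_assoc)
  have quad: "(T *v w) \<bullet> (B *v (T *v w)) = w \<bullet> w" for w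
  proof -
    have "w \<bullet> (transpose T ** B ** T *v w) = (T *v w) \<bullet> (B *v (T *v w))"
      by (simp add: inner_matrix_vector_mult[of w "transpose T"] del: transpose_matrix_vector flip: matrix_vector_mul_assoc)
    then show ?thesis
      by (simp add: T)
  qed
  have "(\<integral>y. ?g y \<partial>lborel) = \<bar>det T\<bar> *\<^sub>R (\<integral>w. ?g (T *v w) \<partial>lborel)"
    by (rule lborel_integral_linear[OF \<open>det T \<noteq> 0\<close>]) measurable
  also have "(\<integral>w. ?g (T *v w) \<partial>lborel) =
      exp (of_real (pi * ((transpose T *v p) \<bullet> (transpose T *v p) - (transpose T *v q) \<bullet> (transpose T *v q)))
        + 2 * of_real pi * \<i> * of_real ((transpose T *v p) \<bullet> (transpose T *v q)))"
    unfolding quad inner_matrix_vector_mult[of p T] inner_matrix_vector_mult[of q T] by (rule lborel_integral_gaussian)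
  finally show ?thesis
    unfolding inner_inv abs_det by (simp add: scaleR_conv_of_real)
qed

section \<open>The bilinear distribution of a Gaussian\<close>

theorem lemma4p1:
  fixes M S :: "real^'n^'n" and lam :: real and x \<omega> :: "real^'n"
  assumes "lam > 0"
    and "S = mat 1 + 4 *\<^sub>R (transpose M ** M)"
  shows "bilinear_dist (mat_AM M) (gauss lam) x \<omega> =
      of_real ((2 * lam) powr (real CARD('n) / 2))
    * of_real (det S powr (- 1 / 2))
    * exp (of_real (- 2 * pi * (x \<bullet> x) / lam))
    * exp (of_real (8 * pi * ((transpose M *v x) \<bullet> (matrix_inv S *v (transpose M *v x))) / lam))
    * exp (8 * of_real pi * \<i> * of_real ((matrix_inv S *v \<omega>) \<bullet> (transpose M *v x)))
    * exp (of_real (- 2 * pi * lam * (\<omega> \<bullet> (matrix_inv S *v \<omega>))))"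
proof -
  define u where "u = transpose M *v x"
  define p where "p = (2 / lam) *\<^sub>R u"
  define B where "B = (1 / (2 * lam)) *\<^sub>R S"
  let ?g = "\<lambda>y. exp (of_real (- pi * (y \<bullet> (B *v y)) - 2 * pi * (p \<bullet> y)) - 2 * of_real pi * \<i> * of_real (\<omega> \<bullet> y)) :: complex"
  have Sv: "S *v v = v + 4 *\<^sub>R (transpose M *v (M *v v))" for v
    by (simp add: assms(2) matrix_vector_mult_add_rdistrib scaleR_matrix_vector_assoc[symmetric] matrix_vector_mul_assoc)
  have S_form: "v \<bullet> (S *v v) = v \<bullet> v + 4 * ((M *v v) \<bullet> (M *v v))" for v
    by (simp add: Sv inner_add_right inner_matrix_vector_mult[of v "transpose M"] del: transpose_matrix_vector)
  have S_pos: "v \<bullet> (S *v v) > 0" if "v \<noteq> 0" for v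
    using that by (simp add: S_form add_pos_nonneg)
  have S_sym: "transpose S = S"
    by (simp add: assms(2) transpose_def vec_eq_iff mat_def matrix_matrix_mult_def mult.commute)
  have B_pos: "v \<bullet> (B *v v) > 0" if "v \<noteq> 0" for v
    using S_pos[OF that] assms(1) by (simp add: B_def scaleR_matrix_vector_assoc[symmetric])
  have B_sym: "transpose B = B"
    using S_sym by (simp add: B_def transpose_def vec_eq_iff)
  have "S ** matrix_inv S = mat 1"
  proof -
    have "invertible S"
      unfolding invertible_left_inverse matrix_left_invertible_ker
      using S_pos by (metis inner_zero_right less_irrefl)
    then show ?thesis
      by (metis invertible_def matrix_inv_eqI)
  qed
  then have inv_B: "matrix_inv B = (2 * lam) *\<^sub>R matrix_inv S"
    using assms(1) by (intro matrix_inv_eqI) (simp add: B_def scalar_matrix_assoc matrix_scalar_ac flip: scalar_mult_eq_scaleR)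
  have det_S: "det S > 0"
    by (rule positive_definite_det_pos[OF S_sym S_pos])
  have det_B: "det B powr (- 1 / 2) = (2 * lam) powr (real CARD('n) / 2) * det S powr (- 1 / 2)"
  proof -
    have "det B = (2 * lam) powr (- real CARD('n)) * det S"
      using assms(1) by (simp add: B_def det_scaleR powr_minus powr_realpow power_one_over inverse_eq_divide)
    then show ?thesis
      using assms(1) det_S by (simp add: powr_mult powr_powr)
  qed
  have integrand: "exp (- 2 * of_real pi * \<i> * of_real (\<omega> \<bullet> y))
        * gauss lam (block11 (mat_AM M) *v x + block12 (mat_AM M) *v y)
        * cnj (gauss lam (block21 (mat_AM M) *v x + block22 (mat_AM M) *v y)) =
      exp (of_real (- 2 * pi * (x \<bullet> x) / lam)) * ?g y" for y
  proof -
    define a where "a = x + (M *v y + (1/2) *\<^sub>R y)"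
    define b where "b = x + (M *v y - (1/2) *\<^sub>R y)"
    have "x \<bullet> (M *v y) = u \<bullet> y"
      by (simp add: u_def inner_matrix_vector_mult)
    then have "a \<bullet> a + b \<bullet> b = 2 * (x \<bullet> x) + 4 * (u \<bullet> y) + (1/2) * (y \<bullet> (S *v y))"
      by (simp add: a_def b_def S_form inner_add_left inner_add_right inner_diff_left inner_diff_right inner_commute algebra_simps)
    then have exponent: "- pi * (a \<bullet> a) / lam + - pi * (b \<bullet> b) / lam =
        - 2 * pi * (x \<bullet> x) / lam + (- pi * (y \<bullet> (B *v y)) - 2 * pi * (p \<bullet> y))"
      using assms(1) by (simp add: B_def p_def scaleR_matrix_vector_assoc[symmetric] field_simps) algebra
    have gauss_exp: "gauss lam (block11 (mat_AM M) *v x + block12 (mat_AM M) *v y) = exp (of_real (- pi * (a \<bullet> a) / lam))"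
      "gauss lam (block21 (mat_AM M) *v x + block22 (mat_AM M) *v y) = exp (of_real (- pi * (b \<bullet> b) / lam))"
      by (simp_all add: gauss_def mat_AM_def a_def b_def matrix_vector_mult_add_rdistrib matrix_vector_mult_diff_rdistrib
          scaleR_matrix_vector_assoc[symmetric] flip: exp_of_real)
    have "exp (- 2 * of_real pi * \<i> * of_real (\<omega> \<bullet> y)) * exp (of_real (- pi * (a \<bullet> a) / lam)) * cnj (exp (of_real (- pi * (b \<bullet> b) / lam))) =
        exp (of_real (- pi * (a \<bullet> a) / lam + - pi * (b \<bullet> b) / lam) - 2 * of_real pi * \<i> * of_real (\<omega> \<bullet> y))"
      by (simp add: exp_cnj algebra_simps flip: exp_add)
    also have "\<dots> = exp (of_real (- 2 * pi * (x \<bullet> x) / lam)) * ?g y"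
      unfolding exponent exp_add[symmetric] by (simp add: algebra_simps)
    finally show ?thesis
      unfolding gauss_exp .
  qed
  have [measurable]: "?g \<in> borel_measurable borel"
    by measurable
  have "bilinear_dist (mat_AM M) (gauss lam) x \<omega> =
      (\<integral>y. exp (of_real (- 2 * pi * (x \<bullet> x) / lam)) * ?g y \<partial>lebesgue)"
    unfolding bilinear_dist_def integrand ..
  also have "\<dots> = (\<integral>y. exp (of_real (- 2 * pi * (x \<bullet> x) / lam)) * ?g y \<partial>lborel)"
    by (rule integral_completion) measurable
  also have "\<dots> = exp (of_real (- 2 * pi * (x \<bullet> x) / lam)) * (\<integral>y. ?g y \<partial>lborel)"
    by (rule integral_mult_right_zero)
  also have "(\<integral>y. ?g y \<partial>lborel) = of_real (det B powr (- 1 / 2)) *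
    exp (of_real (pi * (p \<bullet> (matrix_inv B *v p) - \<omega> \<bullet> (matrix_inv B *v \<omega>)))
      + 2 * of_real pi * \<i> * of_real (p \<bullet> (matrix_inv B *v \<omega>)))"
    by (rule lborel_integral_gaussian_positive_definite[OF B_sym B_pos])
  finally have "bilinear_dist (mat_AM M) (gauss lam) x \<omega> =
      of_real (det B powr (- 1 / 2)) * (exp (of_real (- 2 * pi * (x \<bullet> x) / lam)) *
      exp (of_real (pi * (p \<bullet> (matrix_inv B *v p) - \<omega> \<bullet> (matrix_inv B *v \<omega>)))
        + 2 * of_real pi * \<i> * of_real (p \<bullet> (matrix_inv B *v \<omega>))))"
    by (simp only: mult.left_commute)
  also have "exp (of_real (pi * (p \<bullet> (matrix_inv B *v p) - \<omega> \<bullet> (matrix_inv B *v \<omega>)))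
        + 2 * of_real pi * \<i> * of_real (p \<bullet> (matrix_inv B *v \<omega>))) =
      exp (of_real (8 * pi * (u \<bullet> (matrix_inv S *v u)) / lam))
        * exp (8 * of_real pi * \<i> * of_real ((matrix_inv S *v \<omega>) \<bullet> u))
        * exp (of_real (- 2 * pi * lam * (\<omega> \<bullet> (matrix_inv S *v \<omega>))))"
  proof -
    have "p \<bullet> (matrix_inv B *v p) = 8 * (u \<bullet> (matrix_inv S *v u)) / lam"
      "p \<bullet> (matrix_inv B *v \<omega>) = 4 * ((matrix_inv S *v \<omega>) \<bullet> u)"
      "\<omega> \<bullet> (matrix_inv B *v \<omega>) = 2 * lam * (\<omega> \<bullet> (matrix_inv S *v \<omega>))"
      using assms(1) by (simp_all add: inv_B p_def scaleR_matrix_vector_assoc[symmetric] matrix_vector_mult_scaleR inner_commute)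
    then show ?thesis
      unfolding exp_add[symmetric] by (intro arg_cong[where f = exp]) (simp add: algebra_simps)
  qed
  finally show ?thesis
    unfolding det_B u_def by (simp only: of_real_mult mult.assoc)
qed

end
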